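(* The compositional inverse of the power series $$t-\frac{t^3}{6}+\frac{t^{5}}{120}$$ is of the form $t\,h(t^2)$, where $h$ is a power series with positive coefficients (i.e. every coefficient of $h$ is strictly positive).
   Context: The compositional inverse of a formal power series $f(t)=t+\cdots$ without constant term is the unique formal power series $g(t)$ without constant term with $f(g(t))=g(f(t))=t$. (The displayed series is the Poincaré series, with signs, of the Koszul dual cooperad $(\mathrm{tCom}^3_1)^c$ of the operad $\widetilde{\mathrm{Lie}}{}^3_0$ of ungraded ("mock") Lie $3$-algebras; this is not needed for the statement.) *)

theory Defs
  imports "HOL-Computational_Algebra.Formal_Power_Series"
begin

text \<open>The library's \<open>fps_inv f\<close> is defined by a coefficient recursion; the following confirms
  that it is the unique two-sided compositional inverse without constant term.\<close>

lemma fps_inv_iff_compositional_inverse: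
  fixes f g :: "'a::field fps"
  assumes "fps_nth f 0 = 0" and "fps_nth f 1 \<noteq> 0"
  shows "g = fps_inv f \<longleftrightarrow>
    fps_nth g 0 = 0 \<and> fps_compose f g = fps_X \<and> fps_compose g f = fps_X"
proof
  assume "g = fps_inv f"
  then show "fps_nth g 0 = 0 \<and> fps_compose f g = fps_X \<and> fps_compose g f = fps_X"
    using fps_inv[OF assms] fps_inv_right[OF assms] by (simp add: fps_inv_def)
next
  assume g: "fps_nth g 0 = 0 \<and> fps_compose f g = fps_X \<and> fps_compose g f = fps_X"
  have inv0: "fps_nth (fps_inv f) 0 = 0"
    by (simp add: fps_inv_def)
  have "g = fps_compose g (fps_compose f (fps_inv f))"
    using fps_inv_right[OF assms] by simp
  also have "\<dots> = fps_compose (fps_compose g f) (fps_inv f)"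
    using fps_compose_assoc[OF inv0 assms(1)] by simp
  also have "\<dots> = fps_inv f"
    using g inv0 by (simp add: fps_X_fps_compose_startby0)
  finally show "g = fps_inv f" .
qed

end

theory Submission
  imports Defs "HOL-Computational_Algebra.Formal_Laurent_Series"
begin

unbundle fps_syntax

text \<open>Writing the series as \<open>t / q\<close>, Lagrange inversion expresses the \<open>n\<close>-th coefficient of the
  inverse as \<open>1/n\<close> times the coefficient of \<open>t\<^sup>n\<^sup>-\<^sup>1\<close> in \<open>q\<^sup>n\<close>. With \<open>v = t\<^sup>2\<close> this is the coefficient of
  \<open>v\<^sup>m\<close>, \<open>n = 2 m + 1\<close>, in \<open>(1 - v/6 + v\<^sup>2/120)\<^sup>-\<^sup>n\<close>. The coefficients of the latter power satisfy a
  three-term recurrence, from which consecutive ones have ratio at least \<open>1/4\<close> up to index \<open>m\<close>.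
  (The bound fails for large indices, as \<open>1 - v/6 + v\<^sup>2/120\<close> has no real root.)\<close>

text \<open>As \<open>f\<close> has no constant term, \<open>f ^ k\<close> starts in degree at least
  \<open>k\<close>. Hence all coefficients of the composite up to index \<open>n\<close> can be
  summed over the same range, and the two sums swap.\<close>

lemma fps_nth_compose_mult:
  fixes h f w :: "'a::comm_ring_1 fps"
  assumes "f $ 0 = 0"
  shows "((h oo f) * w) $ n = (\<Sum>k=0..n. h $ k * (f ^ k * w) $ n)"
proof -
  have "(h oo f) $ i = (\<Sum>k=0..n. h $ k * (f ^ k) $ i)" if "i \<le> n" for i
    unfolding fps_compose_nth
    using that startsby_zero_power_prefix[OF assms] by (intro sum.mono_neutral_left) auto
  then have "((h oo f) * w) $ n = (\<Sum>i=0..n. \<Sum>k=0..n. h $ k * ((f ^ k) $ i * w $ (n - i)))"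
    by (simp add: fps_mult_nth sum_distrib_right mult.assoc)
  also have "\<dots> = (\<Sum>k=0..n. h $ k * (f ^ k * w) $ n)"
    by (subst sum.swap) (simp add: fps_mult_nth sum_distrib_left)
  finally show ?thesis .
qed

lemma fps_deriv_inverse_power:
  fixes p :: "'a::field fps"
  assumes "p $ 0 \<noteq> 0"
  shows "fps_deriv (inverse p ^ n) = - (of_nat n * (fps_deriv p * inverse p ^ Suc n))"
  by (cases n) (simp_all only: fps_deriv_power' fps_inverse_deriv[OF assms],
      simp_all add: power2_eq_square mult_ac)

text \<open>For \<open>f = X p\<close>, this coefficient is the residue of \<open>f' / f\<^sup>d\<^sup>+\<^sup>1\<close>; it vanishes for \<open>d > 0\<close>
  because the quotient is then a derivative.\<close>

lemma fps_nth_residue_power: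
  fixes p :: "'a::field_char_0 fps"
  assumes "p $ 0 \<noteq> 0"
  shows "(fps_deriv (fps_X * p) * inverse p ^ Suc d) $ d = (if d = 0 then 1 else 0)"
proof (cases d)
  case 0
  then show ?thesis using assms by simp
next
  case (Suc e)
  let ?q = "inverse p"
  have pq: "p * ?q = 1"
    using assms by (simp add: inverse_mult_eq_1')
  have deriv: "of_nat d * (fps_deriv p * ?q ^ Suc d) = - fps_deriv (?q ^ d)"
    using fps_deriv_inverse_power[OF assms, of d] by simp
  have "fps_deriv (fps_X * p) * ?q ^ Suc d
      = (p * ?q) * ?q ^ d + fps_X * (fps_deriv p * ?q ^ Suc d)"
    by (simp add: algebra_simps)
  then have "of_nat d * (fps_deriv (fps_X * p) * ?q ^ Suc d)
      = of_nat d * ?q ^ d + fps_X * (of_nat d * (fps_deriv p * ?q ^ Suc d))"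
    unfolding pq by (simp only: mult_1 distrib_left mult.left_commute)
  also have "\<dots> = of_nat d * ?q ^ d - fps_X * fps_deriv (?q ^ d)"
    by (simp only: deriv) simp
  finally have "(of_nat d * (fps_deriv (fps_X * p) * ?q ^ Suc d)) $ d
      = (of_nat d * ?q ^ d - fps_X * fps_deriv (?q ^ d)) $ d"
    by (rule arg_cong)
  \<comment> \<open>The coefficient of index \<open>d\<close> in X F' is \<open>d\<close> times that
    of F, so the two terms cancel.\<close>
  also have "\<dots> = 0"
    by (simp add: Suc fps_of_nat[symmetric] del: of_nat_Suc power_Suc)
  finally have "of_nat d * (fps_deriv (fps_X * p) * ?q ^ Suc d) $ d = 0"
    by (simp only: fps_of_nat[symmetric] fps_mult_left_const_nth)
  then show ?thesis
    using Suc by (simp del: of_nat_Suc)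
qed

text \<open>Let f = X p, with compositional inverse g. The chain rule gives g'(f) f' = 1.
  Multiplying p^(-n-1) by this and expanding g'(f) in powers of f yields a sum of residues, of which
  only the one for k = n survives.\<close>

theorem lagrange_inversion:
  fixes p :: "'a::field_char_0 fps"
  assumes p0: "p $ 0 \<noteq> 0"
  shows "of_nat (Suc n) * fps_inv (fps_X * p) $ Suc n = (inverse p ^ Suc n) $ n"
proof -
  let ?q = "inverse p" and ?f = "fps_X * p"
  define g where "g = fps_inv ?f"
  have "g oo ?f = fps_X"
    unfolding g_def using p0 by (intro fps_inv) auto
  then have "(fps_deriv g oo ?f) * fps_deriv ?f = 1"
    using fps_compose_deriv[of ?f g] by simp
  then have "(?q ^ Suc n) $ n = ((fps_deriv g oo ?f) * (fps_deriv ?f * ?q ^ Suc n)) $ n"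
    by (simp add: mult.assoc[symmetric] del: power_Suc)
  also have "\<dots> = (\<Sum>k=0..n. fps_deriv g $ k * (?f ^ k * (fps_deriv ?f * ?q ^ Suc n)) $ n)"
    by (rule fps_nth_compose_mult) simp
  also have "\<dots> = (\<Sum>k=0..n. if k = n then fps_deriv g $ n else 0)"
  proof (rule sum.cong[OF refl])
    fix k assume "k \<in> {0..n}"
    then have k: "k \<le> n" by simp
    \<comment> \<open>The factor \<open>p ^ k\<close> of \<open>?f ^ k\<close> cancels
      \<open>k\<close> factors \<open>?q\<close>; the remaining \<open>fps_X ^ k\<close> shifts the
      index to \<open>n - k\<close>.\<close>
    have "?q ^ Suc n = ?q ^ k * ?q ^ Suc (n - k)"
      using k by (simp only: power_add[symmetric]) simp
    then have "?f ^ k * (fps_deriv ?f * ?q ^ Suc n)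
        = fps_X ^ k * ((p * ?q) ^ k * (fps_deriv ?f * ?q ^ Suc (n - k)))"
      by (simp only: power_mult_distrib mult_ac)
    also have "p * ?q = 1"
      using p0 by (simp add: inverse_mult_eq_1')
    finally have "?f ^ k * (fps_deriv ?f * ?q ^ Suc n)
        = fps_X ^ k * (fps_deriv ?f * ?q ^ Suc (n - k))"
      by (simp only: power_one mult_1)
    then have "(?f ^ k * (fps_deriv ?f * ?q ^ Suc n)) $ n
        = (fps_deriv ?f * ?q ^ Suc (n - k)) $ (n - k)"
      using k by (simp only: fps_X_power_mult_nth) simp
    also have "\<dots> = (if n - k = 0 then 1 else 0)"
      by (rule fps_nth_residue_power[OF p0])
    finally show "fps_deriv g $ k * (?f ^ k * (fps_deriv ?f * ?q ^ Suc n)) $ n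
        = (if k = n then fps_deriv g $ n else 0)"
      using k by auto
  qed
  also have "\<dots> = of_nat (Suc n) * g $ Suc n"
    by (simp add: fps_deriv_nth)
  finally show ?thesis by (simp add: g_def)
qed

text \<open>The power Q = P^(-n) solves P Q' = -n P' Q; the recurrence compares coefficients on both
  sides.\<close>

lemma inverse_quadratic_power_recurrence:
  fixes b c :: "'a::field" and n :: nat
  defines "P \<equiv> 1 - fps_const b * fps_X + fps_const c * fps_X ^ 2"
  defines "a \<equiv> fps_nth (inverse P ^ n)"
  shows "a 0 = 1" "a 1 = of_nat n * b"
    "of_nat (k + 2) * a (k + 2) = b * of_nat (k + 1 + n) * a (k + 1) - c * of_nat (k + 2 * n) * a k"
proof -
  let ?Q = "inverse P ^ n"
  have P0: "P $ 0 = 1" by (simp add: P_def)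
  then have PQ: "P * inverse P = 1" by (simp add: inverse_mult_eq_1')
  have dP: "fps_deriv P = fps_const (2 * c) * fps_X - fps_const b"
    by (simp add: P_def fps_deriv_power' power2_eq_square fps_eq_iff numeral_fps_const)
  have "P * fps_deriv ?Q = - of_nat n * fps_deriv P * ?Q"
  proof -
    have "P * fps_deriv ?Q = - of_nat n * fps_deriv P * ((P * inverse P) * ?Q)"
      using P0 by (simp add: fps_deriv_inverse_power mult_ac)
    then show ?thesis by (simp add: PQ)
  qed
  then have eq: "P * fps_deriv ?Q
      = fps_const (of_nat n * b) * ?Q - fps_const (of_nat n * (2 * c)) * (fps_X * ?Q)"
    unfolding dP by (simp add: algebra_simps fps_of_nat flip: fps_const_mult)
  have lhs: "P * fps_deriv ?Q = fps_deriv ?Q - fps_const b * (fps_X * fps_deriv ?Q)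
      + fps_const c * (fps_X ^ 2 * fps_deriv ?Q)"
    by (simp add: P_def algebra_simps)
  show a0: "a 0 = 1"
    by (simp add: a_def P0 fps_power_zeroth)
  have "(P * fps_deriv ?Q) $ 0 = of_nat n * b * a 0"
    unfolding eq by (simp add: a_def)
  then show "a 1 = of_nat n * b"
    by (simp add: lhs a0) (simp add: a_def)
  have "(P * fps_deriv ?Q) $ (k + 1) = of_nat n * b * a (k + 1) - of_nat n * (2 * c) * a k"
    unfolding eq by (simp add: a_def)
  moreover have "(P * fps_deriv ?Q) $ (k + 1)
      = of_nat (k + 2) * a (k + 2) - b * of_nat (k + 1) * a (k + 1) + c * of_nat k * a k"
    unfolding lhs by (simp add: a_def fps_X_power_mult_nth)
  ultimately have "of_nat (k + 2) * a (k + 2) - b * of_nat (k + 1) * a (k + 1) + c * of_nat k * a k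
      = of_nat n * b * a (k + 1) - of_nat n * (2 * c) * a k"
    by simp
  then show "of_nat (k + 2) * a (k + 2)
      = b * of_nat (k + 1 + n) * a (k + 1) - c * of_nat (k + 2 * n) * a k"
    by (simp add: algebra_simps)
qed

text \<open>Positivity alone is not inductive, since the recurrence subtracts a multiple of
  \<open>a k\<close>. The ratio bound lets the term in \<open>a (k + 1)\<close> absorb it.\<close>

lemma inverse_power_coeff_pos:
  fixes n :: nat
  defines "a \<equiv> fps_nth (inverse (1 - fps_const (1 / 6) * fps_X + fps_const (1 / 120) * fps_X ^ 2) ^ n
    :: real fps)"
  shows "2 * k + 1 \<le> n \<Longrightarrow> a k > 0 \<and> (k > 0 \<longrightarrow> a k \<ge> a (k - 1) / 4)"
proof (induction k)
  case 0
  then show ?case unfolding a_def inverse_quadratic_power_recurrence(1) by simp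
next
  case (Suc k)
  note rec = inverse_quadratic_power_recurrence[where b = "1/6 :: real" and c = "1/120" and n = n,
      folded a_def]
  show ?case
  proof (cases k)
    case 0
    \<comment> \<open>Here \<open>a 1\<close> is n/6 with n \<ge> 3.\<close>
    then show ?thesis using Suc.prems rec(1,2) by simp
  next
    case (Suc j)
    have pos: "a (j + 1) > 0" and ratio: "a j \<le> 4 * a (j + 1)"
      using Suc.IH Suc.prems Suc by auto
    have n: "real n \<ge> 2 * real j + 5"
      using Suc.prems Suc by simp
    have "real (j + 2) * (a (j + 1) / 4) = real (j + 2) / 4 * a (j + 1)"
      by simp
    \<comment> \<open>The constant 1/30 is 4/120, with 4 from the ratio bound. The inequality
      reduces to 7 j + 20 \<le> 6 n.\<close>
    also have "\<dots> \<le> (1/6 * real (j + 1 + n) - 1/30 * real (j + 2 * n)) * a (j + 1)"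
      using n pos by (intro mult_right_mono) (auto simp: field_simps)
    also have "\<dots> = 1/6 * real (j + 1 + n) * a (j + 1) - 1/120 * real (j + 2 * n) * (4 * a (j + 1))"
      by (simp add: algebra_simps)
    also have "\<dots> \<le> 1/6 * real (j + 1 + n) * a (j + 1) - 1/120 * real (j + 2 * n) * a j"
      using ratio by (intro diff_mono mult_left_mono) auto
    also have "\<dots> = real (j + 2) * a (j + 2)"
      by (rule rec(3)[symmetric])
    finally have "real (j + 2) * (a (j + 1) / 4) \<le> real (j + 2) * a (j + 2)" .
    then have "a (j + 1) / 4 \<le> a (j + 2)"
      by (rule mult_left_le_imp_le) simp
    then show ?thesis using pos Suc by simp
  qed
qed

theorem theorem43:
  shows "\<exists>h :: real fps.
    fps_inv (fps_X - fps_const (1 / 6) * fps_X ^ 3 + fps_const (1 / 120) * fps_X ^ 5)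
      = fps_X * fps_compose h (fps_X ^ 2)
    \<and> (\<forall>n. fps_nth h n > 0)"
proof -
  define P :: "real fps"
    where "P = 1 - fps_const (1 / 6) * fps_X + fps_const (1 / 120) * fps_X ^ 2"
  define p where "p = P oo fps_X ^ 2"
  define g where
    "g = fps_inv (fps_X - fps_const (1 / 6) * fps_X ^ 3 + fps_const (1 / 120) * fps_X ^ 5 :: real fps)"
  define h where "h = Abs_fps (\<lambda>m. g $ (2 * m + 1))"
  have P0: "P $ 0 = 1" by (simp add: P_def)
  have "fps_X * p = fps_X - fps_const (1 / 6) * fps_X ^ 3 + fps_const (1 / 120) * fps_X ^ 5"
    by (simp add: p_def P_def fps_compose_add_distrib fps_compose_sub_distrib
        fps_compose_mult_distrib fps_compose_power[symmetric] algebra_simps eval_nat_numeral)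
  then have g: "g = fps_inv (fps_X * p)"
    by (simp add: g_def)
  \<comment> \<open>Powers of 1/p are thus series in t^2, which makes \<open>g\<close> odd.\<close>
  have "inverse p ^ k = inverse P ^ k oo fps_X ^ 2" for k
    using P0 by (simp add: p_def fps_inverse_compose flip: fps_compose_power)
  then have coeff: "real (Suc n) * g $ Suc n = (inverse P ^ Suc n oo fps_X ^ 2) $ n" for n
    using lagrange_inversion[of p n] P0 by (simp only: g) (simp add: p_def)
  have odd: "g $ Suc n = 0" if "odd n" for n
    using coeff[of n] that by (simp add: fps_nth_compose_X_power del: power_Suc of_nat_Suc)
  have pos: "g $ Suc (2 * m) > 0" for m
  proof -
    \<comment> \<open>The index \<open>m\<close> is the last one that the positivity lemma covers
      for exponent 2 m + 1.\<close>
    have "real (Suc (2 * m)) * g $ Suc (2 * m) > 0"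
      unfolding coeff using inverse_power_coeff_pos[of m "Suc (2 * m)"]
      by (simp add: fps_nth_compose_X_power P_def del: power_Suc of_nat_Suc)
    then show ?thesis by (simp add: zero_less_mult_iff del: of_nat_Suc)
  qed
  have "g = fps_X * (h oo fps_X ^ 2)"
  proof (rule fps_ext)
    fix n
    show "g $ n = (fps_X * (h oo fps_X ^ 2)) $ n"
      by (cases n) (auto simp: fps_nth_compose_X_power h_def odd, simp add: g_def fps_inv_def)
  qed
  then show ?thesis
    using pos by (intro exI[of _ h]) (simp add: g_def h_def)
qed

end
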